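(* Let $B_1\subsetneq B_2$ be two nested open balls in $\mathbb{R}^n$ centered at the origin, let $$\mathcal{V}=\{K\in\mathcal{K}_0^n\mid \operatorname{cl}(B_1)\subset\operatorname{int}(K)\subset K\subset B_2\},$$ and let $\mathcal{U}$ be an open neighbourhood of the identity in $\operatorname{Proj}(\mathbb{RP}^n)$ such that for every $K\in\mathcal{V}$ and every $\pi\in\mathcal{U}$ one has $\pi\circ F(K)\subset\mathbb{RP}^n\setminus H_0$ and $F^{-1}\circ\pi\circ F(K)\in\mathcal{K}_0^n$. Then there exist an open neighbourhood $\mathcal{W}$ of $(I_n,0,0)$ in $\mathrm{GL}_n(\mathbb{R})\times\mathbb{R}^n\times\mathbb{R}^n$ and a map $\Psi:\mathcal{W}\to\operatorname{Proj}(\mathbb{RP}^n)$ such that $\Psi(I_n,0,0)=\operatorname{Id}_{\mathbb{RP}^n}$, $\Psi$ is a diffeomorphism onto its image, and $$\operatorname{vp}\big(F^{-1}\circ\Psi(M,x,\xi)\circ F(K)\big)=\mathcal{F}_K(x,\xi)$$ for any convex body $K\in\mathcal{V}$ and any $(M,x,\xi)\in\Psi^{-1}(\mathcal{U})$.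
   Context: $\mathcal{K}_0^n$ denotes the space of convex bodies in $\mathbb{R}^n$ containing the origin in their interior (with the Hausdorff topology); $\operatorname{cl}$ and $\operatorname{int}$ denote closure and interior. For $K\in\mathcal{K}_0^n$, $K^\circ=\{y\in\mathbb{R}^n\mid\langle x,y\rangle\le1\ \forall x\in K\}$ is the polar body, $|\cdot|$ is Lebesgue measure, $\operatorname{vp}(K)=|K|\cdot|K^\circ|$, and $\mathcal{F}_K(x,\xi)=\operatorname{vp}\big((K^\circ+\xi)^\circ+x\big)$, defined for those $(x,\xi)\in\mathbb{R}^n\times\mathbb{R}^n$ with $0\in\operatorname{int}(K^\circ+\xi)$ and $0\in\operatorname{int}((K^\circ+\xi)^\circ+x)$ (an open neighbourhood of $(0,0)$). $\mathbb{RP}^n=(\mathbb{R}^{n+1}\setminus\{0\})/\mathbb{R}^*$ with projective coordinates $[x_0,\dots,x_n]$, and $H_0=\{[x_0,\dots,x_n]\mid x_0=0\}$. A projective transformation is a diffeomorphism of $\mathbb{RP}^n$ induced by a linear isomorphism of $\mathbb{R}^{n+1}$; the group $\operatorname{Proj}(\mathbb{RP}^n)$ of projective transformations is identified with $\mathrm{GL}_{n+1}(\mathbb{R})/(\mathbb{R}^*\cdot I_{n+1})$, with its quotient topology and smooth structure. The affine chart $F:\mathbb{R}^n\to\mathbb{RP}^n\setminus H_0$ is $F(y_1,\dots,y_n)=[1,y_1,\dots,y_n]$, with inverse $F^{-1}[x_0,\dots,x_n]=(x_1/x_0,\dots,x_n/x_0)$. (A neighbourhood $\mathcal{U}$ as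 in the claim exists.) *)

theory Defs
  imports "HOL-Analysis.Analysis"
begin

section \<open>Convex bodies, polarity and the volume product\<close>

definition convex_bodies_0 :: "'a::euclidean_space set set" where
  "convex_bodies_0 = {K. compact K \<and> convex K \<and> 0 \<in> interior K}"

definition polar :: "'a::euclidean_space set \<Rightarrow> 'a set" where
  "polar K = {y. \<forall>x\<in>K. x \<bullet> y \<le> 1}"

definition vp :: "'a::euclidean_space set \<Rightarrow> real" where
  "vp K = measure lebesgue K * measure lebesgue (polar K)"

definition bipolar_shift :: "'a::euclidean_space set \<Rightarrow> 'a \<Rightarrow> 'a \<Rightarrow> 'a set" where
  "bipolar_shift K x \<xi> = (+) x ` polar ((+) \<xi> ` polar K)"

definition vp_shift_dom :: "'a::euclidean_space set \<Rightarrow> ('a \<times> 'a) set" where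
  "vp_shift_dom K =
     {(x, \<xi>). 0 \<in> interior ((+) \<xi> ` polar K) \<and> 0 \<in> interior (bipolar_shift K x \<xi>)}"

text \<open>The function \<open>\<F>\<^sub>K\<close>; only its values on \<^const>\<open>vp_shift_dom\<close> are meaningful.\<close>

definition vp_shift :: "'a::euclidean_space set \<Rightarrow> 'a \<Rightarrow> 'a \<Rightarrow> real" where
  "vp_shift K x \<xi> = vp (bipolar_shift K x \<xi>)"


section \<open>Smooth maps between open subsets of normed spaces\<close>

text \<open>
  Both predicates are meant for open \<open>S\<close> in a finite-dimensional space, where they say that \<open>f\<close> is
  \<open>C\<^sup>k\<close> (resp. \<open>C\<^sup>\<infinity>\<close>) on \<open>S\<close>. Recursion through directional derivatives keeps the codomain type fixed.
\<close>

fun Ck_on :: "nat \<Rightarrow> ('a::real_normed_vector \<Rightarrow> 'b::real_normed_vector) \<Rightarrow> 'a set \<Rightarrow> bool" where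
  "Ck_on 0 f S \<longleftrightarrow> continuous_on S f"
| "Ck_on (Suc k) f S \<longleftrightarrow>
     (\<forall>x\<in>S. f differentiable (at x)) \<and>
     (\<forall>v. Ck_on k (\<lambda>x. frechet_derivative f (at x) v) S)"

definition smooth_on :: "'a::real_normed_vector set \<Rightarrow> ('a \<Rightarrow> 'b::real_normed_vector) \<Rightarrow> bool" where
  "smooth_on S f \<longleftrightarrow> (\<forall>k. Ck_on k f S)"


section \<open>Real projective space\<close>

text \<open>
  For an index type \<open>'n\<close> of cardinality \<open>n\<close>, the space \<open>\<real>\<^sup>n\<^sup>+\<^sup>1\<close> is \<open>real ^ 'n option\<close>: the index \<open>None\<close> is
  the coordinate \<open>x\<^sub>0\<close>, and \<open>Some i\<close> are the remaining ones.
\<close>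

definition proj_rel :: "real ^ ('n::finite) option \<Rightarrow> real ^ 'n option \<Rightarrow> bool" where
  "proj_rel v w \<longleftrightarrow> v \<noteq> 0 \<and> w \<noteq> 0 \<and> (\<exists>c. c \<noteq> 0 \<and> w = c *\<^sub>R v)"

lemma part_equivp_proj_rel: "part_equivp (proj_rel :: real ^ ('n::finite) option \<Rightarrow> _)"
proof (rule part_equivpI)
  have "proj_rel (1 :: real ^ 'n option) 1"
    unfolding proj_rel_def by (auto intro!: exI[of _ 1])
  then show "\<exists>v :: real ^ 'n option. proj_rel v v" ..
  show "symp (proj_rel :: real ^ 'n option \<Rightarrow> _)"
  proof (rule sympI)
    fix v w :: "real ^ 'n option"
    assume "proj_rel v w"
    then obtain c where "v \<noteq> 0" "w \<noteq> 0" "c \<noteq> 0" "w = c *\<^sub>R v" by (auto simp: proj_rel_def)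
    then show "proj_rel w v"
      unfolding proj_rel_def by (auto intro!: exI[of _ "inverse c"])
  qed
  show "transp (proj_rel :: real ^ 'n option \<Rightarrow> _)"
  proof (rule transpI)
    fix u v w :: "real ^ 'n option"
    assume "proj_rel u v" "proj_rel v w"
    then obtain c d where "u \<noteq> 0" "w \<noteq> 0" "c \<noteq> 0" "d \<noteq> 0" "v = c *\<^sub>R u" "w = d *\<^sub>R v"
      by (auto simp: proj_rel_def)
    then show "proj_rel u w"
      unfolding proj_rel_def by (auto intro!: exI[of _ "d * c"])
  qed
qed

quotient_type 'n rproj = "real ^ ('n::finite) option" / partial: proj_rel
  morphisms hrep hclass
  by (rule part_equivp_proj_rel)

text \<open>\<open>hclass v\<close> is the point \<open>[v]\<close>; it is meaningful for \<open>v \<noteq> 0\<close> only.\<close>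

lemma hclass_eq_iff:
  fixes v w :: "real ^ ('n::finite) option"
  assumes "v \<noteq> 0" "w \<noteq> 0"
  shows "hclass v = hclass w \<longleftrightarrow> (\<exists>c. c \<noteq> 0 \<and> w = c *\<^sub>R v)"
proof -
  have refl: "proj_rel u u" if "u \<noteq> 0" for u :: "real ^ 'n option"
    using that unfolding proj_rel_def by (auto intro!: exI[of _ 1])
  have "proj_rel v w \<longleftrightarrow> proj_rel v v \<and> proj_rel w w \<and> hclass v = hclass w"
    by (rule Quotient3_rel[OF Quotient3_rproj, symmetric])
  then show ?thesis
    using refl assms by (auto simp: proj_rel_def)
qed

lemma hclass_hrep [simp]: "hclass (hrep p) = p"
  by (rule Quotient3_abs_rep[OF Quotient3_rproj])

lemma hrep_nonzero [simp]: "hrep p \<noteq> 0"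
  using Quotient3_rep_reflp[OF Quotient3_rproj, of p] by (simp add: proj_rel_def)

lemma hrep_hclass:
  assumes "v \<noteq> 0"
  obtains c where "c \<noteq> 0" "hrep (hclass v) = c *\<^sub>R v"
  using hclass_eq_iff[of v "hrep (hclass v)"] assms by auto

definition hyperplane0 :: "('n::finite) rproj set" where
  "hyperplane0 = {hclass v | v. v \<noteq> 0 \<and> v $ None = 0}"

definition affine_chart :: "real ^ ('n::finite) \<Rightarrow> 'n rproj" where
  "affine_chart y = hclass (\<chi> i. case i of None \<Rightarrow> 1 | Some j \<Rightarrow> y $ j)"

text \<open>The inverse chart \<open>[x\<^sub>0,\<dots>,x\<^sub>n] \<mapsto> (x\<^sub>1/x\<^sub>0,\<dots>,x\<^sub>n/x\<^sub>0)\<close>, to be used off \<^const>\<open>hyperplane0\<close> only.\<close>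

lift_definition affine_coords :: "('n::finite) rproj \<Rightarrow> real ^ 'n"
  is "\<lambda>v. \<chi> i. v $ Some i / v $ None"
  by (auto simp: proj_rel_def)

lemma affine_coords_hclass:
  assumes "v \<noteq> 0"
  shows "affine_coords (hclass v) = (\<chi> i. v $ Some i / v $ None)"
proof -
  obtain c where "c \<noteq> 0" "hrep (hclass v) = c *\<^sub>R v" using hrep_hclass[OF assms] .
  then show ?thesis by (simp add: affine_coords_def)
qed

lemma affine_coords_affine_chart [simp]:
  fixes y :: "real ^ ('n::finite)"
  shows "affine_coords (affine_chart y) = y"
proof -
  have "(\<chi> i. case i of None \<Rightarrow> 1 | Some j \<Rightarrow> y $ j) \<noteq> (0 :: real ^ 'n option)"
    by (auto simp: vec_eq_iff intro!: exI[of _ None])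
  then show ?thesis by (simp add: affine_chart_def affine_coords_hclass)
qed


section \<open>The group of projective transformations\<close>

definition GL :: "(real ^ ('m::finite) ^ 'm) set" where
  "GL = {A. invertible A}"

text \<open>The self-map of projective space induced by a matrix, meaningful for \<open>A \<in> GL\<close> only.\<close>

definition proj_map :: "real ^ ('n::finite) option ^ 'n option \<Rightarrow> 'n rproj \<Rightarrow> 'n rproj" where
  "proj_map A p = hclass (A *v hrep p)"

lemma proj_map_hclass:
  assumes "A \<in> GL" "v \<noteq> 0"
  shows "proj_map A (hclass v) = hclass (A *v v)"
proof -
  obtain c where c: "c \<noteq> 0" "hrep (hclass v) = c *\<^sub>R v" using hrep_hclass[OF assms(2)] .
  obtain B where "B ** A = mat 1" using assms(1) by (auto simp: GL_def invertible_def)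
  then have "A *v v \<noteq> 0"
    using assms(2) by (metis matrix_vector_mul_assoc matrix_vector_mul_lid matrix_vector_mult_0_right)
  then have "hclass (A *v v) = hclass (c *\<^sub>R (A *v v))"
    using c by (subst hclass_eq_iff) auto
  then show ?thesis
    by (simp add: proj_map_def c(2) matrix_vector_mult_scaleR)
qed

definition Proj :: "(('n::finite) rproj \<Rightarrow> 'n rproj) set" where
  "Proj = proj_map ` GL"

text \<open>
  The quotient topology of \<^const>\<open>proj_map\<close> on \<open>Proj = GL\<^sub>n\<^sub>+\<^sub>1(\<real>)/\<real>\<^sup>*\<close>: a set is open iff its preimage
  in \<^const>\<open>GL\<close> is.
\<close>

definition Proj_topology :: "(('n::finite) rproj \<Rightarrow> 'n rproj) topology" where
  "Proj_topology =
     topology (\<lambda>U. U \<subseteq> Proj \<and> openin (top_of_set GL) {A \<in> GL. proj_map A \<in> U})"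

lemma openin_Proj_topology:
  fixes U :: "(('n::finite) rproj \<Rightarrow> 'n rproj) set"
  shows "openin Proj_topology U \<longleftrightarrow> U \<subseteq> Proj \<and> openin (top_of_set GL) {A \<in> GL. proj_map A \<in> U}"
proof -
  have "istopology (\<lambda>U :: ('n rproj \<Rightarrow> 'n rproj) set. U \<subseteq> Proj \<and> openin (top_of_set GL) {A \<in> GL. proj_map A \<in> U})"
    unfolding istopology_def
  proof (intro conjI allI impI)
    fix S T :: "('n rproj \<Rightarrow> 'n rproj) set"
    assume S: "S \<subseteq> Proj \<and> openin (top_of_set GL) {A \<in> GL. proj_map A \<in> S}"
      and T: "T \<subseteq> Proj \<and> openin (top_of_set GL) {A \<in> GL. proj_map A \<in> T}"
    have "{A \<in> GL. proj_map A \<in> S \<inter> T} = {A \<in> GL. proj_map A \<in> S} \<inter> {A \<in> GL. proj_map A \<in> T}"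
      by auto
    then show "openin (top_of_set GL) {A \<in> GL. proj_map A \<in> S \<inter> T}"
      using S T by auto
    from S show "S \<inter> T \<subseteq> Proj" by auto
  next
    fix \<K> :: "('n rproj \<Rightarrow> 'n rproj) set set"
    assume *: "\<forall>K\<in>\<K>. K \<subseteq> Proj \<and> openin (top_of_set GL) {A \<in> GL. proj_map A \<in> K}"
    have "{A \<in> GL. proj_map A \<in> \<Union>\<K>} = (\<Union>K\<in>\<K>. {A \<in> GL. proj_map A \<in> K})" by auto
    then show "openin (top_of_set GL) {A \<in> GL. proj_map A \<in> \<Union>\<K>}"
      using * by auto
    show "\<Union>\<K> \<subseteq> Proj" using * by auto
  qed
  then show ?thesis by (simp add: Proj_topology_def)
qed

lemma topspace_Proj_topology [simp]:
  "topspace Proj_topology = (Proj :: (('n::finite) rproj \<Rightarrow> 'n rproj) set)"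
proof -
  have "{A \<in> GL. proj_map A \<in> Proj} = (GL :: (real ^ 'n option ^ 'n option) set)"
    by (auto simp: Proj_def)
  then have "openin Proj_topology (Proj :: ('n rproj \<Rightarrow> 'n rproj) set)"
    by (simp add: openin_Proj_topology)
  then show ?thesis
    by (meson openin_Proj_topology openin_subset openin_topspace subset_antisym)
qed

lemma quotient_map_proj_map: "quotient_map (top_of_set GL) Proj_topology proj_map"
  by (auto simp: quotient_map_def openin_Proj_topology Proj_def)

text \<open>
  The quotient smooth structure, i.e. the one making \<^const>\<open>proj_map\<close> a submersion, is given by its
  smooth functions: \<open>g\<close> is smooth on an open \<open>U \<subseteq> Proj\<close> iff \<open>g \<circ> proj_map\<close> is smooth on the preimage of
  \<open>U\<close> in \<^const>\<open>GL\<close>. A continuous map \<open>f\<close> from an open subset of a vector space into \<^const>\<open>Proj\<close> is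
  smooth iff it pulls back smooth real functions, defined on open subsets, to smooth functions.
\<close>

definition smooth_from_Proj ::
  "(('n::finite) rproj \<Rightarrow> 'n rproj) set \<Rightarrow> (('n rproj \<Rightarrow> 'n rproj) \<Rightarrow> 'b::real_normed_vector) \<Rightarrow> bool"
where
  "smooth_from_Proj U g \<longleftrightarrow> smooth_on {A \<in> GL. proj_map A \<in> U} (g \<circ> proj_map)"

definition smooth_into_Proj ::
  "'a::real_normed_vector set \<Rightarrow> ('a \<Rightarrow> (('n::finite) rproj \<Rightarrow> 'n rproj)) \<Rightarrow> bool"
where
  "smooth_into_Proj W f \<longleftrightarrow>
     continuous_map (top_of_set W) Proj_topology f \<and>
     (\<forall>U (g :: ('n rproj \<Rightarrow> 'n rproj) \<Rightarrow> real).
        openin Proj_topology U \<and> smooth_from_Proj U g \<longrightarrow> smooth_on {w \<in> W. f w \<in> U} (g \<circ> f))"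

text \<open>
  Used for \<open>W\<close> open in a space of dimension \<open>(n+1)\<^sup>2 - 1 = dim Proj\<close>, so that the image is an open
  submanifold.
\<close>

definition diffeo_onto_image_Proj ::
  "'a::real_normed_vector set \<Rightarrow> ('a \<Rightarrow> (('n::finite) rproj \<Rightarrow> 'n rproj)) \<Rightarrow> bool"
where
  "diffeo_onto_image_Proj W f \<longleftrightarrow>
     inj_on f W \<and> openin Proj_topology (f ` W) \<and>
     smooth_into_Proj W f \<and> smooth_from_Proj (f ` W) (inv_into W f)"

end

theory Submission
  imports Defs
begin

text \<open>
  The operation \<open>K \<mapsto> (K\<degree> + \<xi>)\<degree> + x\<close> is itself a projective transformation of \<open>K\<close>. By the bipolar theorem,
  \<open>(K\<degree> + \<xi>)\<degree>\<close> is the image of \<open>K\<close> under \<open>k \<mapsto> k / (1 + \<xi> \<bullet> k)\<close> as soon as \<open>1 + \<xi> \<bullet> k > 0\<close> on \<open>K\<close>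
  (\<open>polar_shift_polar\<close>). Following it by the translation by \<open>x\<close> and a linear map \<open>M\<close>, which leaves the
  volume product unchanged (\<open>vp_linear_image\<close>), gives the projective map of the matrix
  \<open>[[1, \<xi>\<^sup>T], [M x, M + M x \<xi>\<^sup>T]]\<close>. This is \<open>\<Psi>(M, x, \<xi>)\<close>, for all
  \<open>(M, x, \<xi>)\<close> in \<open>W = GL \<times> \<real>\<^sup>n \<times> \<real>\<^sup>n\<close>.

  A matrix in \<open>GL\<close> with nonzero first entry can be scaled to have first entry \<open>1\<close>, and then has this form
  for a unique \<open>(M, x, \<xi>)\<close>: \<open>\<xi>\<close> is the rest of its first row, \<open>M\<close> is its Schur complement, and \<open>M x\<close> is the
  rest of its first column. As the matrix of a projective map is determined up to a scalar
  (\<open>proj_map_eq_iff\<close>), \<open>\<Psi>\<close> is injective with open image. Its entries are polynomials in the parameters,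
  and by Cramer's rule its inverse is rational in the entries of the matrix, so both directions are
  smooth (\<open>diffeo_proj_of_params\<close>).

  For \<open>\<pi> = \<Psi>(M, x, \<xi>)\<close> in the given neighbourhood, the hypothesis that the image of \<open>K\<close> stays off the hyperplane
  and contains \<open>0\<close> in its interior provides what is needed for \<open>(x, \<xi>)\<close> to be in the domain of the
  shifted volume product (\<open>vp_proj_of_params\<close>).
\<close>

section \<open>Calculus of functions of class C^k\<close>

text \<open>
  A function of class \<open>C\<^sup>k\<close> is replaced by another expression for it only on \<open>S\<close>, while the
  recursion differentiates total functions; openness of \<open>S\<close> makes the derivatives agree again.
\<close>

lemma Ck_on_cong:
  assumes "open S" and "\<And>x. x \<in> S \<Longrightarrow> f x = g x" and "Ck_on k f S"
  shows "Ck_on k g S"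
  using assms(2,3)
proof (induction k arbitrary: f g)
  case 0
  then show ?case
    by (metis Ck_on.simps(1) continuous_on_cong)
next
  case (Suc k)
  have deriv: "(g has_derivative frechet_derivative f (at x)) (at x)" if "x \<in> S" for x
  proof (rule has_derivative_transform_within_open[OF _ assms(1) that])
    show "(f has_derivative frechet_derivative f (at x)) (at x)"
      using Suc.prems that by (simp add: frechet_derivative_works[symmetric])
  qed (rule Suc.prems)
  have "Ck_on k (\<lambda>x. frechet_derivative g (at x) v) S" for v
  proof (rule Suc.IH)
    show "Ck_on k (\<lambda>x. frechet_derivative f (at x) v) S"
      using Suc.prems by simp
  qed (use deriv in \<open>metis frechet_derivative_at\<close>)
  with deriv show ?case
    by (auto simp: differentiable_def)
qed

lemma Ck_on_SucI:
  assumes "open S" and "\<And>x. x \<in> S \<Longrightarrow> (f has_derivative f' x) (at x)"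
    and "\<And>v. Ck_on k (\<lambda>x. f' x v) S"
  shows "Ck_on (Suc k) f S"
proof -
  have "Ck_on k (\<lambda>x. frechet_derivative f (at x) v) S" for v
    by (rule Ck_on_cong[OF assms(1) _ assms(3)[of v]])
       (use assms(2) in \<open>metis frechet_derivative_at\<close>)
  with assms(2) show ?thesis
    by (auto simp: differentiable_def)
qed

lemma Ck_on_SucD:
  assumes "Ck_on (Suc k) f S"
  shows "\<And>x. x \<in> S \<Longrightarrow> (f has_derivative frechet_derivative f (at x)) (at x)"
    and "\<And>v. Ck_on k (\<lambda>x. frechet_derivative f (at x) v) S"
  using assms by (auto simp: frechet_derivative_works[symmetric])

lemma Ck_on_Suc_imp_Ck_on: "Ck_on (Suc k) f S \<Longrightarrow> Ck_on k f S"
proof (induction k arbitrary: f)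
  case 0
  then show ?case
    by (auto intro!: continuous_at_imp_continuous_on differentiable_imp_continuous_within)
next
  case (Suc k)
  from Suc.prems have "\<forall>x\<in>S. f differentiable (at x)"
    by simp
  moreover have "Ck_on k (\<lambda>x. frechet_derivative f (at x) v) S" for v
    using Suc.prems by (intro Suc.IH) simp
  ultimately show ?case by simp
qed

lemma Ck_on_const: "open S \<Longrightarrow> Ck_on k (\<lambda>_. c) S"
proof (induction k arbitrary: c)
  case (Suc k)
  then show ?case
    by (intro Ck_on_SucI[where f' = "\<lambda>_ _. 0"]) auto
qed simp

lemma Ck_on_linear:
  assumes "bounded_linear L" and "open S" and "Ck_on k f S"
  shows "Ck_on k (\<lambda>x. L (f x)) S"
  using assms(3)
proof (induction k arbitrary: f)
  case 0
  then show ?case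
    by (simp add: bounded_linear.continuous_on[OF assms(1)])
next
  case (Suc k)
  note D = Ck_on_SucD[OF Suc.prems]
  show ?case
    by (rule Ck_on_SucI[OF assms(2) bounded_linear.has_derivative[OF assms(1) D(1)] Suc.IH[OF D(2)]])
qed

lemma Ck_on_id: "open S \<Longrightarrow> Ck_on k (\<lambda>x. x) S"
  by (cases k) (auto intro!: Ck_on_SucI[where f' = "\<lambda>_ v. v"] Ck_on_const)

lemma Ck_on_add:
  assumes "open S" and "Ck_on k f S" and "Ck_on k g S"
  shows "Ck_on k (\<lambda>x. f x + g x) S"
  using assms(2,3)
proof (induction k arbitrary: f g)
  case 0
  then show ?case by (simp add: continuous_on_add)
next
  case (Suc k)
  note D = Ck_on_SucD[OF Suc.prems(1)] Ck_on_SucD[OF Suc.prems(2)]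
  show ?case
    by (rule Ck_on_SucI[OF assms(1) has_derivative_add[OF D(1,3)] Suc.IH[OF D(2,4)]])
qed

lemma Ck_on_sum:
  assumes "open S" and "\<And>i. i \<in> I \<Longrightarrow> Ck_on k (f i) S"
  shows "Ck_on k (\<lambda>x. \<Sum>i\<in>I. f i x) S"
  using assms(2)
  by (induction I rule: infinite_finite_induct) (auto intro: assms(1) Ck_on_const Ck_on_add)

text \<open>
  The Leibniz rule \<open>D(P(f, g)) v = P(f, Dg v) + P(Df v, g)\<close> contains the undifferentiated factors, which
  have to be known to be of class \<open>C\<^sup>k\<close> as well; hence the need for \<open>Ck_on_Suc_imp_Ck_on\<close>.
\<close>

lemma Ck_on_bilinear:
  assumes "bounded_bilinear P" and "open S" and "Ck_on k f S" and "Ck_on k g S"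
  shows "Ck_on k (\<lambda>x. P (f x) (g x)) S"
  using assms(3,4)
proof (induction k arbitrary: f g)
  case 0
  then show ?case by (simp add: bounded_bilinear.continuous_on[OF assms(1)])
next
  case (Suc k)
  note D = Ck_on_SucD[OF Suc.prems(1)] Ck_on_SucD[OF Suc.prems(2)]
  note lower = Ck_on_Suc_imp_Ck_on[OF Suc.prems(1)] Ck_on_Suc_imp_Ck_on[OF Suc.prems(2)]
  show ?case
    by (rule Ck_on_SucI[OF assms(2) bounded_bilinear.FDERIV[OF assms(1) D(1,3)]])
       (assumption | intro Ck_on_add assms(2) Suc.IH D lower)+
qed

lemmas Ck_on_mult = Ck_on_bilinear[OF bounded_bilinear_mult]
lemmas Ck_on_scaleR = Ck_on_bilinear[OF bounded_bilinear_scaleR]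

lemma Ck_on_diff:
  assumes "open S" and "Ck_on k f S" and "Ck_on k g S"
  shows "Ck_on k (\<lambda>x. f x - g x) S"
  using Ck_on_add[OF assms(1,2) Ck_on_linear[OF bounded_linear_minus[OF bounded_linear_ident] assms(1,3)]]
  by simp

lemma Ck_on_prod:
  fixes f :: "'i \<Rightarrow> 'a::real_normed_vector \<Rightarrow> real"
  assumes "open S" and "\<And>i. i \<in> I \<Longrightarrow> Ck_on k (f i) S"
  shows "Ck_on k (\<lambda>x. \<Prod>i\<in>I. f i x) S"
  using assms(2)
  by (induction I rule: infinite_finite_induct) (auto intro: assms(1) Ck_on_const Ck_on_mult)

text \<open>
  The derivative of \<open>1 / f\<close> is again a polynomial in \<open>1 / f\<close> and the derivative of \<open>f\<close>, so one degree of
  smoothness is gained at each step of the induction.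
\<close>

lemma Ck_on_inverse:
  fixes f :: "'a::real_normed_vector \<Rightarrow> real"
  assumes "open S" and "Ck_on k f S" and "\<And>x. x \<in> S \<Longrightarrow> f x \<noteq> 0"
  shows "Ck_on k (\<lambda>x. inverse (f x)) S"
  using assms(2)
proof (induction k)
  case 0
  then show ?case by (auto intro!: continuous_on_inverse simp: assms(3))
next
  case (Suc k)
  note D = Ck_on_SucD[OF Suc.prems]
  note inv = Suc.IH[OF Ck_on_Suc_imp_Ck_on[OF Suc.prems]]
  show ?case
  proof (rule Ck_on_SucI[OF assms(1)])
    show "((\<lambda>x. inverse (f x)) has_derivative
        (\<lambda>v. - (inverse (f x) * frechet_derivative f (at x) v * inverse (f x)))) (at x)" if "x \<in> S" for x
      by (rule Deriv.has_derivative_inverse[OF assms(3)[OF that] D(1)[OF that]])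
    show "Ck_on k (\<lambda>x. - (inverse (f x) * frechet_derivative f (at x) v * inverse (f x))) S" for v
      by (intro Ck_on_linear[OF bounded_linear_minus[OF bounded_linear_ident]] Ck_on_mult assms(1) inv D(2))
  qed
qed

lemma Ck_on_divide:
  fixes f g :: "'a::real_normed_vector \<Rightarrow> real"
  assumes "open S" and "Ck_on k f S" and "Ck_on k g S" and "\<And>x. x \<in> S \<Longrightarrow> g x \<noteq> 0"
  shows "Ck_on k (\<lambda>x. f x / g x) S"
  using Ck_on_mult[OF assms(1,2) Ck_on_inverse[OF assms(1,3,4)]] by (simp add: divide_inverse)

lemma Ck_on_vec_nth: "open S \<Longrightarrow> Ck_on k f S \<Longrightarrow> Ck_on k (\<lambda>x. f x $ i) S"
  by (rule Ck_on_linear[OF bounded_linear_vec_nth])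

lemma Ck_on_vec_lambda:
  fixes f :: "'n::finite \<Rightarrow> 'a::real_normed_vector \<Rightarrow> 'b::euclidean_space"
  assumes "open S" and "\<And>i. Ck_on k (f i) S"
  shows "Ck_on k (\<lambda>x. \<chi> i. f i x) S"
proof -
  have eq: "(\<Sum>i\<in>UNIV. axis i (f i x)) = (\<chi> i. f i x)" for x
    by (simp add: vec_eq_iff axis_def sum.delta if_distrib cong: if_cong)
  have lin: "bounded_linear (axis i :: 'b \<Rightarrow> 'b ^ 'n)" for i
    unfolding linear_conv_bounded_linear[symmetric]
    by (rule linearI) (auto simp: vec_eq_iff axis_def)
  have "Ck_on k (\<lambda>x. \<Sum>i\<in>UNIV. axis i (f i x)) S"
    by (intro Ck_on_sum assms(1) Ck_on_linear[OF lin] assms(2))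
  then show ?thesis by (simp add: eq)
qed

lemma Ck_on_Pair:
  assumes "open S" and "Ck_on k f S" and "Ck_on k g S"
  shows "Ck_on k (\<lambda>x. (f x, g x)) S"
  using Ck_on_add[OF assms(1)
      Ck_on_linear[OF bounded_linear_Pair[OF bounded_linear_ident bounded_linear_zero] assms(1,2)]
      Ck_on_linear[OF bounded_linear_Pair[OF bounded_linear_zero bounded_linear_ident] assms(1,3)]]
  by simp

lemma Ck_on_det:
  fixes f :: "'a::real_normed_vector \<Rightarrow> real ^ 'n ^ 'n::finite"
  assumes "open S" and "\<And>i j. Ck_on k (\<lambda>x. f x $ i $ j) S"
  shows "Ck_on k (\<lambda>x. det (f x)) S"
  unfolding det_def by (intro Ck_on_sum Ck_on_mult Ck_on_prod Ck_on_const assms)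

text \<open>
  In the chain rule the direction \<open>Df(x) v\<close> in which \<open>h\<close> is differentiated varies with \<open>x\<close>, whereas the
  recursion only provides derivatives in constant directions. Expanding the direction in an
  orthonormal basis separates the two dependencies; this is where finite dimension is used.
\<close>

lemma Ck_on_compose:
  fixes f :: "'a::real_normed_vector \<Rightarrow> 'b::euclidean_space"
    and h :: "'b \<Rightarrow> 'c::real_normed_vector"
  assumes "open S" and "open T" and "f ` S \<subseteq> T" and "Ck_on k f S" and "Ck_on k h T"
  shows "Ck_on k (\<lambda>x. h (f x)) S"
  using assms(4,5)
proof (induction k arbitrary: h)
  case 0
  then show ?case
    using assms(3) by (simp add: continuous_on_compose2)
next
  case (Suc k)
  note Df = Ck_on_SucD[OF Suc.prems(1)] and Dh = Ck_on_SucD[OF Suc.prems(2)]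
  note f = Ck_on_Suc_imp_Ck_on[OF Suc.prems(1)]
  show ?case
  proof (rule Ck_on_SucI[OF assms(1)])
    show "((\<lambda>x. h (f x)) has_derivative
        (\<lambda>v. frechet_derivative h (at (f x)) (frechet_derivative f (at x) v))) (at x)" if "x \<in> S" for x
      using that assms(3) by (intro has_derivative_compose[OF Df(1) Dh(1)]) auto
    fix v
    have expand: "(\<Sum>b\<in>Basis. (frechet_derivative f (at x) v \<bullet> b) *\<^sub>R frechet_derivative h (at (f x)) b) =
        frechet_derivative h (at (f x)) (frechet_derivative f (at x) v)" if "x \<in> S" for x
    proof -
      have lin: "linear (frechet_derivative h (at (f x)))"
        using that assms(3) by (intro has_derivative_linear[OF Dh(1)]) auto
      show ?thesis
        by (subst (4) euclidean_representation[symmetric])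
           (simp add: linear_sum[OF lin] linear_cmul[OF lin])
    qed
    show "Ck_on k (\<lambda>x. frechet_derivative h (at (f x)) (frechet_derivative f (at x) v)) S"
      by (rule Ck_on_cong[OF assms(1) expand])
         (assumption | intro Ck_on_sum Ck_on_scaleR assms(1) Ck_on_linear[OF bounded_linear_inner_left] Df(2)
           Suc.IH[OF f] Dh(2))+
  qed
qed

section \<open>Polar bodies\<close>

lemma closed_polar: "closed (polar K)"
proof -
  have "polar K = (\<Inter>x\<in>K. {y. x \<bullet> y \<le> 1})"
    by (auto simp: polar_def)
  then show ?thesis by (simp add: closed_INT closed_halfspace_le)
qed

lemma bounded_polar:
  assumes "0 \<in> interior K"
  shows "bounded (polar K)"
proof -
  obtain e where e: "e > 0" "cball 0 e \<subseteq> K"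
    using assms by (meson mem_interior_cball)
  have "norm y \<le> 1 / e" if "y \<in> polar K" for y
  proof (cases "y = 0")
    case False
    then have "(e / norm y) *\<^sub>R y \<in> K"
      using e by auto
    then have "((e / norm y) *\<^sub>R y) \<bullet> y \<le> 1"
      using that by (auto simp: polar_def)
    then show ?thesis
      using False e(1) by (simp add: dot_square_norm field_simps power2_eq_square)
  qed (use e in auto)
  then show ?thesis by (auto simp: bounded_iff)
qed

text \<open>
  The bipolar theorem. A hyperplane \<open>{x. a \<bullet> x = b}\<close> separating a point from \<open>K\<close> misses \<open>0\<close>, hence can be
  scaled to an element of the polar body that excludes the point from the bipolar.
\<close>

lemma polar_polar:
  assumes "closed K" and "convex K" and "0 \<in> K"
  shows "polar (polar K) = K"
proof
  show "K \<subseteq> polar (polar K)"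
    by (auto simp: polar_def inner_commute)
  show "polar (polar K) \<subseteq> K"
  proof (rule ccontr)
    assume "\<not> polar (polar K) \<subseteq> K"
    then obtain z where z: "z \<in> polar (polar K)" "z \<notin> K" by auto
    obtain a b where ab: "a \<bullet> z < b" "\<And>x. x \<in> K \<Longrightarrow> b < a \<bullet> x"
      using separating_hyperplane_closed_point[OF assms(2,1) z(2)] by blast
    have "b < 0"
      using ab(2)[OF assms(3)] by simp
    have "x \<bullet> ((1 / b) *\<^sub>R a) \<le> 1" if "x \<in> K" for x
      using ab(2)[OF that] \<open>b < 0\<close> by (simp add: inner_commute divide_le_eq_1)
    then have "(1 / b) *\<^sub>R a \<in> polar K"
      by (auto simp: polar_def)
    then have "((1 / b) *\<^sub>R a) \<bullet> z \<le> 1"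
      using z(1) unfolding polar_def mem_Collect_eq by blast
    then show False
      using ab(1) \<open>b < 0\<close> by (simp add: divide_le_eq_1)
  qed
qed

text \<open>
  By compactness \<open>1 + \<xi> \<bullet> k\<close> is bounded below by some \<open>\<epsilon> > 0\<close> on \<open>K\<close>, so that \<open>-\<xi>\<close> satisfies all inequalities
  \<open>k \<bullet> y \<le> 1\<close> with a margin \<open>\<epsilon>\<close>, and remains in the polar body after a small perturbation.
\<close>

lemma zero_interior_shift_polar:
  assumes "compact K" and pos: "\<And>k. k \<in> K \<Longrightarrow> 0 < 1 + \<xi> \<bullet> k"
  shows "0 \<in> interior ((+) \<xi> ` polar K)"
proof (cases "K = {}")
  case True
  then show ?thesis by (simp add: polar_def)
next
  case False
  have "continuous_on K (\<lambda>k. 1 + \<xi> \<bullet> k)"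
    by (intro continuous_intros)
  from continuous_attains_inf[OF assms(1) False this]
  obtain \<epsilon> where \<epsilon>: "0 < \<epsilon>" "\<And>k. k \<in> K \<Longrightarrow> \<epsilon> \<le> 1 + \<xi> \<bullet> k"
    using pos by metis
  obtain R where R: "0 < R" "\<And>k. k \<in> K \<Longrightarrow> norm k \<le> R"
    using compact_imp_bounded[OF assms(1)] by (auto simp: bounded_pos)
  have "w \<in> (+) \<xi> ` polar K" if "norm w < \<epsilon> / R" for w
  proof -
    have "k \<bullet> (w - \<xi>) \<le> 1" if k: "k \<in> K" for k
    proof -
      have "k \<bullet> w \<le> norm k * norm w"
        by (rule norm_cauchy_schwarz)
      also have "\<dots> \<le> R * (\<epsilon> / R)"
        using that R(2)[OF k] R(1) \<open>norm w < \<epsilon> / R\<close> by (intro mult_mono) auto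
      finally show ?thesis
        using \<epsilon>(2)[OF k] R(1) by (simp add: inner_diff_right inner_commute)
    qed
    then have "w - \<xi> \<in> polar K"
      by (auto simp: polar_def)
    then show ?thesis
      by (intro image_eqI[where x = "w - \<xi>"]) auto
  qed
  then have "ball 0 (\<epsilon> / R) \<subseteq> (+) \<xi> ` polar K" by auto
  moreover have "0 < \<epsilon> / R"
    using \<epsilon>(1) R(1) by simp
  ultimately show ?thesis by (meson mem_interior)
qed

text \<open>
  Translating the polar body by \<open>\<xi>\<close> is dual to a projective map: \<open>(\<xi> + y) \<bullet> z \<le> 1\<close> says
  \<open>y \<bullet> z \<le> 1 - \<xi> \<bullet> z\<close>, so if \<open>1 - \<xi> \<bullet> z > 0\<close> then \<open>z / (1 - \<xi> \<bullet> z)\<close> is in the bipolar of \<open>K\<close>, that is in \<open>K\<close>. The map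
  \<open>z \<mapsto> z / (1 - \<xi> \<bullet> z)\<close> is inverse to \<open>k \<mapsto> k / (1 + \<xi> \<bullet> k)\<close>.
\<close>

lemma polar_shift_polar:
  assumes "compact K" and "convex K" and "0 \<in> K" and pos: "\<And>k. k \<in> K \<Longrightarrow> 0 < 1 + \<xi> \<bullet> k"
  shows "polar ((+) \<xi> ` polar K) = (\<lambda>k. (1 / (1 + \<xi> \<bullet> k)) *\<^sub>R k) ` K"
proof
  show "(\<lambda>k. (1 / (1 + \<xi> \<bullet> k)) *\<^sub>R k) ` K \<subseteq> polar ((+) \<xi> ` polar K)"
  proof -
    have "(\<xi> + y) \<bullet> ((1 / (1 + \<xi> \<bullet> k)) *\<^sub>R k) \<le> 1" if "k \<in> K" "y \<in> polar K" for k y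
    proof -
      have "y \<bullet> k \<le> 1"
        using that by (auto simp: polar_def inner_commute)
      then show ?thesis
        using pos[OF that(1)] by (simp add: inner_add_left divide_le_eq_1)
    qed
    then show ?thesis by (auto simp: polar_def)
  qed
  show "polar ((+) \<xi> ` polar K) \<subseteq> (\<lambda>k. (1 / (1 + \<xi> \<bullet> k)) *\<^sub>R k) ` K"
  proof
    fix z assume "z \<in> polar ((+) \<xi> ` polar K)"
    then have z: "(\<xi> + y) \<bullet> z \<le> 1" if "y \<in> polar K" for y
      using that by (auto simp: polar_def)
    obtain R where R: "0 < R" "\<And>k. k \<in> K \<Longrightarrow> norm k \<le> R"
      using compact_imp_bounded[OF assms(1)] by (auto simp: bounded_pos)
    \<comment> \<open>A small positive multiple of \<open>\<xi>\<close> is in the polar body; testing \<open>z\<close> against it, instead of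
      against \<open>0\<close>, makes the inequality \<open>\<xi> \<bullet> z < 1\<close> strict.\<close>
    define s where "s = 1 / (R * (norm \<xi> + 1))"
    have s: "0 < s"
      using R(1) by (simp add: s_def add_nonneg_pos)
    have "s *\<^sub>R \<xi> \<in> polar K"
    proof -
      have "k \<bullet> (s *\<^sub>R \<xi>) \<le> 1" if "k \<in> K" for k
      proof -
        have "k \<bullet> \<xi> \<le> norm k * norm \<xi>"
          by (rule norm_cauchy_schwarz)
        also have "\<dots> \<le> R * (norm \<xi> + 1)"
          using R(1) R(2)[OF that] by (intro mult_mono) auto
        finally show ?thesis
          using R(1) by (simp add: s_def add_nonneg_pos divide_le_eq_1)
      qed
      then show ?thesis by (simp add: polar_def)
    qed
    from z[OF this] have "(1 + s) * (\<xi> \<bullet> z) \<le> 1"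
      by (simp add: inner_add_left algebra_simps)
    then have lt: "\<xi> \<bullet> z < 1"
      using s by (smt (verit) mult_less_cancel_right1)
    define k where "k = (1 / (1 - \<xi> \<bullet> z)) *\<^sub>R z"
    have "y \<bullet> k \<le> 1" if "y \<in> polar K" for y
      using z[OF that] lt by (simp add: k_def inner_add_left divide_le_eq_1)
    then have "k \<in> polar (polar K)"
      by (auto simp: polar_def)
    then have "k \<in> K"
      using polar_polar[of K] assms(1-3) by (simp add: compact_imp_closed)
    moreover have "1 + \<xi> \<bullet> k = 1 / (1 - \<xi> \<bullet> z)"
      using lt by (simp add: k_def field_simps)
    then have "z = (1 / (1 + \<xi> \<bullet> k)) *\<^sub>R k"
      using lt by (simp add: k_def)
    ultimately show "z \<in> (\<lambda>k. (1 / (1 + \<xi> \<bullet> k)) *\<^sub>R k) ` K" by blast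
  qed
qed

section \<open>Linear invariance of the volume product\<close>

text \<open>
  This form of \<open>(f K)\<degree> = f\<^sup>-\<^sup>T K\<degree>\<close> avoids the inverse: in \<open>vp_linear_image_wellorder\<close> the factor \<open>|det f|\<close> then
  appears on both sides of the equation between the two volume products.
\<close>

lemma adjoint_image_polar:
  fixes f :: "'a::euclidean_space \<Rightarrow> 'b::euclidean_space"
  assumes "linear f" and "inj f"
  shows "adjoint f ` polar (f ` K) = polar K"
proof
  show "adjoint f ` polar (f ` K) \<subseteq> polar K"
    by (auto simp: polar_def adjoint_works[OF assms(1)])
  show "polar K \<subseteq> adjoint f ` polar (f ` K)"
  proof
    fix z assume z: "z \<in> polar K"
    obtain y where y: "z = adjoint f y"
      using surj_adjoint_iff_inj[OF assms(1)] assms(2) by (metis surjD)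
    with z have "y \<in> polar (f ` K)"
      by (auto simp: polar_def adjoint_works[OF assms(1)])
    with y show "z \<in> adjoint f ` polar (f ` K)" by blast
  qed
qed

lemma vp_linear_image_wellorder:
  fixes f :: "real ^ 'n::{finite,wellorder} \<Rightarrow> real ^ 'n::_"
  assumes "linear f" and "inj f" and "compact K" and "0 \<in> interior K"
  shows "vp (f ` K) = vp K"
proof -
  have "0 \<in> f ` interior K"
    using assms(4) linear_0[OF assms(1)] by (metis image_eqI)
  then have "0 \<in> interior (f ` K)"
    using assms(1,2) by (simp add: interior_injective_linear_image)
  then have "polar (f ` K) \<in> lmeasurable"
    by (simp add: lmeasurable_compact compact_eq_bounded_closed bounded_polar closed_polar)
  from measure_linear_image[OF adjoint_linear[OF assms(1)] this]
  have "measure lebesgue (polar K) = \<bar>det (matrix f)\<bar> * measure lebesgue (polar (f ` K))"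
    using assms(1,2) by (simp add: adjoint_image_polar matrix_adjoint det_transpose)
  moreover have "measure lebesgue (f ` K) = \<bar>det (matrix f)\<bar> * measure lebesgue K"
    by (rule measure_linear_image[OF assms(1) lmeasurable_compact[OF assms(3)]])
  ultimately show ?thesis by (simp add: vp_def)
qed

text \<open>
  The change of variables formula behind \<open>vp_linear_image_wellorder\<close> concerns coordinates indexed by a
  well-ordered type. An arbitrary finite index type is therefore replaced by a copy of an initial
  segment of the natural numbers of the same cardinality; relabelling the coordinates is an isometry
  that preserves Lebesgue measure.
\<close>

typedef ('n::finite) ordered_index = "{0..<CARD('n)}"
  by (rule exI[of _ 0]) simp

instantiation ordered_index :: (finite) wellorder
begin

definition less_eq_ordered_index :: "'a ordered_index \<Rightarrow> 'a ordered_index \<Rightarrow> bool" where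
  "less_eq_ordered_index i j \<longleftrightarrow> Rep_ordered_index i \<le> Rep_ordered_index j"

definition less_ordered_index :: "'a ordered_index \<Rightarrow> 'a ordered_index \<Rightarrow> bool" where
  "less_ordered_index i j \<longleftrightarrow> Rep_ordered_index i < Rep_ordered_index j"

instance
proof
  fix P :: "'a ordered_index \<Rightarrow> bool" and i
  assume step: "\<And>i. (\<And>j. j < i \<Longrightarrow> P j) \<Longrightarrow> P i"
  show "P i"
    by (induction i rule: measure_induct_rule[where f = Rep_ordered_index])
       (use step in \<open>auto simp: less_ordered_index_def\<close>)
qed (auto simp: less_eq_ordered_index_def less_ordered_index_def Rep_ordered_index_inject)

end

lemma UNIV_ordered_index: "(UNIV :: ('n::finite) ordered_index set) = Abs_ordered_index ` {0..<CARD('n)}"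
  using Rep_ordered_index_inverse Rep_ordered_index by (metis UNIV_eq_I image_eqI)

instance ordered_index :: (finite) finite
  by standard (simp add: UNIV_ordered_index)

lemma card_ordered_index: "CARD(('n::finite) ordered_index) = CARD('n)"
  using type_definition.card[OF type_definition_ordered_index] by simp

definition permute_coords :: "('m \<Rightarrow> 'n) \<Rightarrow> real ^ 'n \<Rightarrow> real ^ 'm" where
  "permute_coords s x = (\<chi> j. x $ s j)"

lemma linear_permute_coords: "linear (permute_coords s)"
  by (rule linearI) (auto simp: permute_coords_def vec_eq_iff)

lemma permute_coords_permute_coords:
  "permute_coords s (permute_coords t x) = permute_coords (t \<circ> s) x"
  by (simp add: permute_coords_def vec_eq_iff)

lemma permute_coords_id: "permute_coords id x = x"
  by (simp add: permute_coords_def vec_eq_iff)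

lemma inner_permute_coords:
  fixes s :: "'m::finite \<Rightarrow> 'n::finite"
  assumes "bij s"
  shows "permute_coords s x \<bullet> permute_coords s y = x \<bullet> y"
  using sum.reindex_bij_betw[OF assms, of "\<lambda>i. x $ i * y $ i"]
  by (simp add: inner_vec_def permute_coords_def)

lemma prod_Basis_vec:
  fixes g :: "real \<Rightarrow> 'b::comm_monoid_mult"
  shows "(\<Prod>b\<in>Basis. g (x \<bullet> b)) = (\<Prod>i\<in>UNIV. g ((x :: real ^ 'n::finite) $ i))"
proof -
  have B: "(Basis :: (real ^ 'n) set) = range (\<lambda>i. axis i 1)"
    by (auto simp: Basis_vec_def)
  have "inj (\<lambda>i::'n. axis i (1::real))"
    by (auto simp: inj_def axis_eq_axis)
  then show ?thesis
    unfolding B by (subst prod.reindex) (auto simp: inner_axis)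
qed

text \<open>
  Relabelling maps boxes to boxes with the same side lengths, and Lebesgue measure is determined by
  its values on boxes.
\<close>

lemma lborel_permute_coords:
  fixes s :: "'m::finite \<Rightarrow> 'n::finite"
  assumes "bij s"
  shows "distr lborel borel (permute_coords s) = lborel"
proof (rule lborel_eqI[symmetric])
  fix l u :: "real ^ 'm"
  assume le: "\<And>b. b \<in> Basis \<Longrightarrow> l \<bullet> b \<le> u \<bullet> b"
  have lei: "l $ j \<le> u $ j" for j
    using le[of "axis j 1"] by (auto simp: Basis_vec_def inner_axis)
  define t where "t = inv s"
  have t: "bij t" "\<And>j. t (s j) = j" "\<And>i. s (t i) = i"
    using assms by (auto simp: t_def bij_imp_bij_inv bij_is_inj bij_is_surj surj_f_inv_f)
  have "permute_coords s -` box l u = box (permute_coords t l) (permute_coords t u)"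
    unfolding set_eq_iff vimage_eq
    by (simp add: mem_box_cart permute_coords_def) (metis t(2,3))
  moreover have "permute_coords s \<in> borel_measurable borel"
    using linear_continuous_on[OF linear_permute_coords[THEN linear_conv_bounded_linear[THEN iffD1]]]
    by (rule borel_measurable_continuous_onI)
  ultimately have "emeasure (distr lborel borel (permute_coords s)) (box l u) =
      emeasure lborel (box (permute_coords t l) (permute_coords t u))"
    by (simp add: emeasure_distr)
  also have "\<dots> = (\<Prod>b\<in>Basis. (permute_coords t u - permute_coords t l) \<bullet> b)"
    using lei by (subst emeasure_lborel_box) (auto simp: Basis_vec_def inner_axis permute_coords_def)
  also have "(\<Prod>b\<in>Basis. (permute_coords t u - permute_coords t l) \<bullet> b) = (\<Prod>i\<in>UNIV. (u - l) $ t i)"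
    using prod_Basis_vec[of "\<lambda>x. x" "permute_coords t u - permute_coords t l"] by (simp add: permute_coords_def)
  also have "\<dots> = (\<Prod>j\<in>UNIV. (u - l) $ j)"
    by (rule prod.reindex_bij_betw[OF t(1)])
  also have "\<dots> = (\<Prod>b\<in>Basis. (u - l) \<bullet> b)"
    using prod_Basis_vec[of "\<lambda>x. x" "u - l"] by simp
  finally show "emeasure (distr lborel borel (permute_coords s)) (box l u) = (\<Prod>b\<in>Basis. (u - l) \<bullet> b)" .
qed simp

lemma measure_permute_coords:
  fixes s :: "'m::finite \<Rightarrow> 'n::finite"
  assumes "bij s" and "closed S"
  shows "measure lebesgue (permute_coords s ` S) = measure lebesgue S"
proof -
  define t where "t = inv s"
  have t: "bij t" "\<And>j. t (s j) = j" "\<And>i. s (t i) = i"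
    using assms(1) by (auto simp: t_def bij_imp_bij_inv bij_is_inj bij_is_surj surj_f_inv_f)
  have meas: "permute_coords t \<in> borel_measurable borel"
    using linear_continuous_on[OF linear_permute_coords[THEN linear_conv_bounded_linear[THEN iffD1]]]
    by (rule borel_measurable_continuous_onI)
  have inverse: "permute_coords s (permute_coords t x) = x" "permute_coords t (permute_coords s y) = y" for x y
    using t(2,3) by (simp_all add: permute_coords_def)
  have eq: "permute_coords s ` S = permute_coords t -` S"
    by (auto simp: inverse intro: image_eqI[where x = "permute_coords t _"])
  have S: "S \<in> sets borel"
    using assms(2) by (simp add: borel_closed)
  have "permute_coords t -` S \<in> sets borel"
    using measurable_sets[OF meas S] by simp
  then have "measure lebesgue (permute_coords s ` S) = measure lborel (permute_coords t -` S)"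
    unfolding eq by simp
  also have "\<dots> = measure (distr lborel borel (permute_coords t)) S"
    using meas S by (simp add: measure_distr)
  also have "\<dots> = measure lebesgue S"
    using S by (simp add: lborel_permute_coords[OF t(1)])
  finally show ?thesis .
qed

lemma vp_permute_coords:
  fixes s :: "'m::finite \<Rightarrow> 'n::finite"
  assumes "bij s" and "closed K"
  shows "vp (permute_coords s ` K) = vp K"
proof -
  have inverse: "permute_coords s (permute_coords (inv s) y) = y" for y :: "real ^ 'm"
    using assms(1) by (simp add: permute_coords_def bij_is_inj)
  have inverse': "permute_coords (inv s) (permute_coords s x) = x" for x :: "real ^ 'n"
    using assms(1) by (simp add: permute_coords_def bij_is_surj surj_f_inv_f)
  have "polar (permute_coords s ` K) = permute_coords s ` polar K"
  proof (rule set_eqI)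
    fix y
    have "y \<in> polar (permute_coords s ` K) \<longleftrightarrow> permute_coords (inv s) y \<in> polar K"
      using inner_permute_coords[OF assms(1), of _ "permute_coords (inv s) y"]
      by (simp add: polar_def inverse)
    also have "\<dots> \<longleftrightarrow> y \<in> permute_coords s ` polar K"
      by (metis image_iff inverse inverse')
    finally show "y \<in> polar (permute_coords s ` K) \<longleftrightarrow> y \<in> permute_coords s ` polar K" .
  qed
  then show ?thesis
    using assms by (simp add: vp_def measure_permute_coords closed_polar)
qed

lemma compact_linear_image:
  fixes f :: "'a::euclidean_space \<Rightarrow> 'b::euclidean_space"
  assumes "compact K" and "linear f"
  shows "compact (f ` K)"
  using assms by (simp add: compact_continuous_image linear_continuous_on linear_conv_bounded_linear)

text \<open>
  Conjugating \<open>f\<close> with a relabelling of the coordinates reduces the claim to a well-ordered index type.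
\<close>

lemma vp_linear_image:
  fixes f :: "real ^ 'n::finite \<Rightarrow> real ^ 'n"
  assumes "linear f" and "inj f" and "compact K" and "0 \<in> interior K"
  shows "vp (f ` K) = vp K"
proof -
  obtain s :: "'n ordered_index \<Rightarrow> 'n" where s: "bij s"
    using finite_same_card_bij[of "UNIV :: 'n ordered_index set" "UNIV :: 'n set"]
    by (auto simp: card_ordered_index)
  define t where "t = inv s"
  have t: "bij t" "t \<circ> s = id" "s \<circ> t = id"
    using s bij_is_surj[OF s, unfolded surj_iff] by (simp_all add: t_def bij_imp_bij_inv bij_is_inj)
  let ?S = "permute_coords s" and ?T = "permute_coords t"
  have inverse: "?S (?T x) = x" "?T (?S y) = y" for x y
    using t(2,3) by (simp_all add: permute_coords_permute_coords permute_coords_id)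
  define g where "g = ?S \<circ> f \<circ> ?T"
  have "linear g"
    unfolding g_def by (intro linear_compose linear_permute_coords assms(1))
  moreover have "inj ?S" "inj ?T"
    by (metis injI inverse)+
  then have "inj g"
    unfolding g_def by (intro inj_compose assms(2))
  ultimately have g: "linear g" "inj g"
    by blast+
  have "g ` ?S ` K = ?S ` f ` K"
    by (simp add: g_def image_image inverse)
  moreover have "closed (f ` K)"
    by (intro compact_imp_closed compact_linear_image[OF assms(3)] assms(1))
  ultimately have "vp (f ` K) = vp (g ` ?S ` K)"
    by (simp add: vp_permute_coords[OF s])
  also have "\<dots> = vp (?S ` K)"
  proof (rule vp_linear_image_wellorder[OF g])
    show "compact (?S ` K)"
      by (intro compact_linear_image[OF assms(3)] linear_permute_coords)
    have "open (?S ` interior K)"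
      using open_surjective_linear_image[OF open_interior linear_permute_coords] inverse(1) by (metis surjI)
    moreover have "0 \<in> ?S ` interior K"
      using assms(4) linear_0[OF linear_permute_coords[of s]] by (metis image_eqI)
    ultimately show "0 \<in> interior (?S ` K)"
      by (meson image_mono interior_subset interiorI)
  qed
  also have "\<dots> = vp K"
    using assms(3) by (simp add: vp_permute_coords[OF s] compact_imp_closed)
  finally show ?thesis .
qed

section \<open>Homogeneous coordinates and block matrices\<close>

definition homog :: "real \<Rightarrow> real ^ 'n::finite \<Rightarrow> real ^ 'n option" where
  "homog c v = (\<chi> i. case i of None \<Rightarrow> c | Some j \<Rightarrow> v $ j)"

lemma homog_nth [simp]: "homog c v $ None = c" "homog c v $ Some i = v $ i"
  by (simp_all add: homog_def)

lemma homog_eq_0_iff [simp]: "homog c v = 0 \<longleftrightarrow> c = 0 \<and> v = 0"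
  by (auto simp: vec_eq_iff homog_def split: option.splits)

lemma homog_cases:
  obtains c v where "w = homog c v"
proof
  show "w = homog (w $ None) (\<chi> i. w $ Some i)"
    by (auto simp: vec_eq_iff homog_def split: option.splits)
qed

lemma affine_chart_eq_homog: "affine_chart y = hclass (homog 1 y)"
  by (simp add: affine_chart_def homog_def)

lemma sum_UNIV_option: "(\<Sum>i\<in>UNIV. f i) = f None + (\<Sum>i\<in>UNIV. f (Some (i::'n::finite)))"
  by (simp add: UNIV_option_conv sum.reindex)

text \<open>
  This is the matrix \<open>[[1, \<xi>\<^sup>T], [u, M + u \<xi>\<^sup>T]]\<close>. With the block \<open>M + u \<xi>\<^sup>T\<close> the Schur complement of the
  entry \<open>1\<close> is \<open>M\<close>, so that invertibility depends on \<open>M\<close> alone.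
\<close>

definition proj_block :: "real ^ 'n ^ 'n \<Rightarrow> real ^ 'n \<Rightarrow> real ^ 'n::finite \<Rightarrow> real ^ 'n option ^ 'n option" where
  "proj_block M u \<xi> = (\<chi> i j. case i of
      None \<Rightarrow> (case j of None \<Rightarrow> 1 | Some b \<Rightarrow> \<xi> $ b)
    | Some a \<Rightarrow> (case j of None \<Rightarrow> u $ a | Some b \<Rightarrow> M $ a $ b + u $ a * \<xi> $ b))"

lemma proj_block_nth [simp]:
  "proj_block M u \<xi> $ None $ None = 1"
  "proj_block M u \<xi> $ None $ Some b = \<xi> $ b"
  "proj_block M u \<xi> $ Some a $ None = u $ a"
  "proj_block M u \<xi> $ Some a $ Some b = M $ a $ b + u $ a * \<xi> $ b"
  by (simp_all add: proj_block_def)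

lemma proj_block_mult_homog:
  "proj_block M u \<xi> *v homog c v = homog (c + \<xi> \<bullet> v) (M *v v + (c + \<xi> \<bullet> v) *\<^sub>R u)"
proof -
  have "(proj_block M u \<xi> *v homog c v) $ i = homog (c + \<xi> \<bullet> v) (M *v v + (c + \<xi> \<bullet> v) *\<^sub>R u) $ i" for i
    by (cases i) (simp_all add: matrix_vector_mult_def sum_UNIV_option inner_vec_def algebra_simps
        sum.distrib sum_distrib_left)
  then show ?thesis by (simp add: vec_eq_iff)
qed

lemma GL_iff_kernel: "A \<in> GL \<longleftrightarrow> (\<forall>x. A *v x = 0 \<longrightarrow> x = 0)"
  by (simp add: GL_def invertible_left_inverse matrix_left_invertible_ker)

lemma proj_block_in_GL_iff: "proj_block M u \<xi> \<in> GL \<longleftrightarrow> M \<in> GL"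
proof
  assume A: "proj_block M u \<xi> \<in> GL"
  have "v = 0" if "M *v v = 0" for v
  proof -
    have "proj_block M u \<xi> *v homog (- (\<xi> \<bullet> v)) v = 0"
      using that by (simp add: proj_block_mult_homog)
    with A have "homog (- (\<xi> \<bullet> v)) v = 0"
      by (meson GL_iff_kernel)
    then show ?thesis by simp
  qed
  then show "M \<in> GL" by (simp add: GL_iff_kernel)
next
  assume M: "M \<in> GL"
  have "w = 0" if "proj_block M u \<xi> *v w = 0" for w
  proof -
    obtain c v where w: "w = homog c v" by (rule homog_cases)
    have c: "c + \<xi> \<bullet> v = 0" and "M *v v + (c + \<xi> \<bullet> v) *\<^sub>R u = 0"
      using that unfolding w proj_block_mult_homog homog_eq_0_iff by blast+
    then have "M *v v = 0"
      by (simp only: c scaleR_zero_left add_0_right)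
    with M have "v = 0" by (meson GL_iff_kernel)
    with c w show ?thesis by simp
  qed
  then show "proj_block M u \<xi> \<in> GL" by (simp add: GL_iff_kernel)
qed

lemma scaleR_mem_GL_iff: "c \<noteq> 0 \<Longrightarrow> c *\<^sub>R A \<in> GL \<longleftrightarrow> A \<in> GL"
  by (simp add: GL_iff_kernel scaleR_matrix_vector_assoc[symmetric])

lemma matrix_scalar_if_all_eigenvectors:
  fixes C :: "real ^ 'm ^ 'm::finite"
  assumes "\<And>v. v \<noteq> 0 \<Longrightarrow> \<exists>c. C *v v = c *\<^sub>R v"
  obtains c where "C = c *\<^sub>R mat 1"
proof -
  have off: "C $ i $ j = 0" if "i \<noteq> j" for i j
  proof -
    have "axis j (1::real) \<noteq> 0" by (simp add: axis_eq_0_iff)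
    from assms[OF this] obtain c where c: "C *v axis j 1 = c *\<^sub>R axis j 1" by blast
    have "C $ i $ j = (C *v axis j 1) $ i"
      by (simp add: matrix_vector_mult_basis column_def)
    also have "\<dots> = 0"
      unfolding c using that by (simp add: axis_def)
    finally show ?thesis .
  qed
  \<comment> \<open>The vector with all coordinates \<open>1\<close> picks out the diagonal entries and shows that they agree.\<close>
  have "(1 :: real ^ 'm) \<noteq> 0"
    by (simp add: vec_eq_iff)
  from assms[OF this] obtain c where c: "C *v 1 = c *\<^sub>R 1" by blast
  have "C $ i $ i = c" for i
  proof -
    have "(C *v 1) $ i = (\<Sum>j\<in>UNIV. C $ i $ j)"
      by (simp add: matrix_vector_mult_def)
    also have "\<dots> = C $ i $ i"
      by (rule sum.remove[of UNIV i, THEN trans]) (auto simp: off intro!: sum.neutral)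
    finally show ?thesis by (simp add: c)
  qed
  then have "C = c *\<^sub>R mat 1"
    using off by (simp add: vec_eq_iff mat_def)
  then show ?thesis by (rule that)
qed

text \<open>
  If \<open>A\<close> and \<open>B\<close> induce the same map, then every nonzero vector is an eigenvector of \<open>A\<^sup>-\<^sup>1 B\<close>, which is
  therefore scalar. This is the identification of projective maps with \<open>GL\<^sub>n\<^sub>+\<^sub>1(\<real>) / \<real>\<^sup>*\<close>.
\<close>

lemma proj_map_eq_iff:
  fixes A B :: "real ^ 'n option ^ 'n::finite option"
  assumes "A \<in> GL" and "B \<in> GL"
  shows "proj_map A = proj_map B \<longleftrightarrow> (\<exists>c. c \<noteq> 0 \<and> B = c *\<^sub>R A)"
proof
  assume eq: "proj_map A = proj_map B"
  obtain A' where A': "A ** A' = mat 1" "A' ** A = mat 1"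
    using assms(1) by (auto simp: GL_def invertible_def)
  have "\<exists>c. (A' ** B) *v v = c *\<^sub>R v" if "v \<noteq> 0" for v
  proof -
    have nz: "A *v v \<noteq> 0" "B *v v \<noteq> 0"
      using assms that by (meson GL_iff_kernel)+
    have "hclass (A *v v) = hclass (B *v v)"
      using fun_cong[OF eq, of "hclass v"] assms that by (simp add: proj_map_hclass)
    then obtain c where c: "B *v v = c *\<^sub>R (A *v v)"
      using hclass_eq_iff[OF nz] by blast
    have "(A' ** B) *v v = A' *v (B *v v)"
      by (simp add: matrix_vector_mul_assoc)
    also have "\<dots> = c *\<^sub>R ((A' ** A) *v v)"
      unfolding c by (simp add: matrix_vector_mult_scaleR matrix_vector_mul_assoc)
    finally have "(A' ** B) *v v = c *\<^sub>R v"
      by (simp add: A')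
    then show ?thesis ..
  qed
  then obtain c where c: "A' ** B = c *\<^sub>R mat 1"
    by (rule matrix_scalar_if_all_eigenvectors)
  have "B = A ** (A' ** B)"
    by (simp add: matrix_mul_assoc A')
  also have "\<dots> = c *\<^sub>R A"
    unfolding c by (simp add: matrix_eq matrix_vector_mul_assoc[symmetric]
        scaleR_matrix_vector_assoc[symmetric] matrix_vector_mult_scaleR)
  finally have B: "B = c *\<^sub>R A" .
  have "c \<noteq> 0"
    using assms(2) unfolding GL_iff_kernel B
    by (metis scaleR_zero_left matrix_vector_mult_0 one_neq_zero one_index zero_index)
  with B show "\<exists>c. c \<noteq> 0 \<and> B = c *\<^sub>R A" by blast
next
  assume "\<exists>c. c \<noteq> 0 \<and> B = c *\<^sub>R A"
  then obtain c where c: "c \<noteq> 0" "B = c *\<^sub>R A" by blast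
  have "hclass (A *v hrep p) = hclass (B *v hrep p)" for p
  proof -
    have "A *v hrep p \<noteq> 0" "B *v hrep p \<noteq> 0"
      using assms hrep_nonzero by (meson GL_iff_kernel)+
    then show ?thesis
      using c by (auto simp: hclass_eq_iff scaleR_matrix_vector_assoc[symmetric])
  qed
  then show "proj_map A = proj_map B"
    by (simp add: proj_map_def fun_eq_iff)
qed

section \<open>Parametrising the projective maps that keep the origin in the affine chart\<close>

text \<open>
  In the affine chart the map with parameters \<open>(M, x, \<xi>)\<close> is \<open>k \<mapsto> M (x + k / (1 + \<xi> \<bullet> k))\<close>. The map
  \<open>k \<mapsto> x + k / (1 + \<xi> \<bullet> k)\<close> is the effect on \<open>K\<close> of translating \<open>K\<degree>\<close> by \<open>\<xi>\<close>, polarising, and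
  translating by \<open>x\<close>; the linear map \<open>M\<close> provides the remaining \<open>n\<^sup>2\<close> dimensions of the projective group.
\<close>

definition proj_of_params :: "(real ^ 'n ^ 'n) \<times> (real ^ 'n) \<times> (real ^ 'n::finite) \<Rightarrow> 'n rproj \<Rightarrow> 'n rproj" where
  "proj_of_params = (\<lambda>(M, x, \<xi>). proj_map (proj_block M (M *v x) \<xi>))"

definition pivot_column :: "real ^ 'n option ^ 'n option \<Rightarrow> real ^ 'n::finite" where
  "pivot_column A = (\<chi> i. A $ Some i $ None / A $ None $ None)"

definition pivot_row :: "real ^ 'n option ^ 'n option \<Rightarrow> real ^ 'n::finite" where
  "pivot_row A = (\<chi> j. A $ None $ Some j / A $ None $ None)"

definition schur_complement :: "real ^ 'n option ^ 'n option \<Rightarrow> real ^ 'n ^ 'n::finite" where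
  "schur_complement A = (\<chi> i j. A $ Some i $ Some j / A $ None $ None - pivot_column A $ i * pivot_row A $ j)"

text \<open>
  The inverse of \<open>proj_of_params\<close>, on representing matrices. The middle component is the solution \<open>x\<close> of
  \<open>M x = u\<close>; writing it by Cramer's rule makes it visibly a rational function of the entries.
\<close>

definition params_of_matrix :: "real ^ 'n option ^ 'n option \<Rightarrow> (real ^ 'n ^ 'n) \<times> (real ^ 'n) \<times> (real ^ 'n::finite)" where
  "params_of_matrix A =
     (schur_complement A,
      \<chi> k. det (\<chi> i j. if j = k then pivot_column A $ i else schur_complement A $ i $ j)
             / det (schur_complement A),
      pivot_row A)"

lemma matrix_eq_proj_block:
  assumes "A $ None $ None \<noteq> 0"
  shows "A = A $ None $ None *\<^sub>R proj_block (schur_complement A) (pivot_column A) (pivot_row A)"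
proof -
  have "A $ i $ j = (A $ None $ None *\<^sub>R proj_block (schur_complement A) (pivot_column A) (pivot_row A)) $ i $ j" for i j
    using assms by (cases i; cases j) (simp_all add: schur_complement_def pivot_column_def pivot_row_def)
  then show ?thesis by (intro vec_eq_iff[THEN iffD2] allI)
qed

lemma schur_complement_in_GL:
  assumes "A \<in> GL" and "A $ None $ None \<noteq> 0"
  shows "schur_complement A \<in> GL"
proof -
  have "A $ None $ None *\<^sub>R proj_block (schur_complement A) (pivot_column A) (pivot_row A) \<in> GL"
    using assms(1) by (subst (asm) matrix_eq_proj_block[OF assms(2)])
  then show ?thesis
    by (simp add: scaleR_mem_GL_iff[OF assms(2)] proj_block_in_GL_iff)
qed

lemma proj_of_params_of_matrix:
  assumes "A \<in> GL" and "A $ None $ None \<noteq> 0"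
  shows "params_of_matrix A \<in> GL \<times> UNIV \<times> UNIV" and "proj_of_params (params_of_matrix A) = proj_map A"
proof -
  let ?M = "schur_complement A"
  have M: "?M \<in> GL" by (rule schur_complement_in_GL[OF assms])
  then show "params_of_matrix A \<in> GL \<times> UNIV \<times> UNIV"
    by (simp add: params_of_matrix_def)
  have "det ?M \<noteq> 0"
    using M by (simp add: GL_def invertible_det_nz)
  then have "?M *v fst (snd (params_of_matrix A)) = pivot_column A"
    by (subst cramer) (simp_all add: params_of_matrix_def)
  then have "proj_of_params (params_of_matrix A) = proj_map (proj_block ?M (pivot_column A) (pivot_row A))"
    by (simp add: proj_of_params_def params_of_matrix_def)
  also have "\<dots> = proj_map A"
  proof (subst proj_map_eq_iff)
    show "\<exists>c. c \<noteq> 0 \<and> A = c *\<^sub>R proj_block ?M (pivot_column A) (pivot_row A)"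
      using matrix_eq_proj_block[OF assms(2)] assms(2) by blast
  qed (use M assms(1) in \<open>simp_all add: proj_block_in_GL_iff\<close>)
  finally show "proj_of_params (params_of_matrix A) = proj_map A" .
qed

lemma proj_of_params_eq_proj_map_imp_pivot:
  assumes "A \<in> GL" and "M \<in> GL" and "proj_of_params (M, x, \<xi>) = proj_map A"
  shows "A $ None $ None \<noteq> 0"
proof -
  obtain c where "c \<noteq> 0" "A = c *\<^sub>R proj_block M (M *v x) \<xi>"
    using assms proj_map_eq_iff[of "proj_block M (M *v x) \<xi>" A]
    by (auto simp: proj_of_params_def proj_block_in_GL_iff)
  then show ?thesis by simp
qed

text \<open>
  Two normalised matrices can only be proportional with factor \<open>1\<close>, because both have \<open>1\<close> as their first
  entry.
\<close>

lemma inj_on_proj_of_params: "inj_on proj_of_params (GL \<times> UNIV \<times> UNIV)"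
proof (rule inj_onI)
  fix w w' :: "(real ^ 'n ^ 'n) \<times> (real ^ 'n) \<times> (real ^ 'n)"
  assume "w \<in> GL \<times> UNIV \<times> UNIV" "w' \<in> GL \<times> UNIV \<times> UNIV" and eq: "proj_of_params w = proj_of_params w'"
  then obtain M x \<xi> M' x' \<xi>' where w: "w = (M, x, \<xi>)" "w' = (M', x', \<xi>')" and GL: "M \<in> GL" "M' \<in> GL"
    by (metis mem_Times_iff prod.collapse)
  from eq obtain c where c: "proj_block M' (M' *v x') \<xi>' = c *\<^sub>R proj_block M (M *v x) \<xi>"
    using proj_map_eq_iff[of "proj_block M (M *v x) \<xi>" "proj_block M' (M' *v x') \<xi>'"] GL
    by (auto simp: w proj_of_params_def proj_block_in_GL_iff)
  have entry: "proj_block M' (M' *v x') \<xi>' $ i $ j = c * proj_block M (M *v x) \<xi> $ i $ j" for i j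
    by (simp add: c)
  have "c = 1"
    using entry[of None None] by simp
  then have \<xi>: "\<xi>' = \<xi>" and u: "M' *v x' = M *v x"
    using entry[of None "Some _"] entry[of "Some _" None] by (simp_all add: vec_eq_iff)
  then have M: "M' = M"
    using entry[of "Some _" "Some _"] \<open>c = 1\<close> by (simp add: vec_eq_iff)
  have "M *v (x' - x) = 0"
    using u by (simp add: M matrix_vector_mult_diff_distrib)
  with GL(1) have "x' = x"
    by (metis GL_iff_kernel eq_iff_diff_eq_0)
  with \<xi> M w show "w = w'" by simp
qed

lemma proj_map_in_image_proj_of_params_iff:
  assumes "A \<in> GL"
  shows "proj_map A \<in> proj_of_params ` (GL \<times> UNIV \<times> UNIV) \<longleftrightarrow> A $ None $ None \<noteq> 0"
proof
  assume "proj_map A \<in> proj_of_params ` (GL \<times> UNIV \<times> UNIV)"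
  then show "A $ None $ None \<noteq> 0"
    using proj_of_params_eq_proj_map_imp_pivot[OF assms] by force
next
  assume "A $ None $ None \<noteq> 0"
  from proj_of_params_of_matrix[OF assms this]
  show "proj_map A \<in> proj_of_params ` (GL \<times> UNIV \<times> UNIV)" by (metis image_eqI)
qed

lemma open_GL: "open (GL :: (real ^ 'n ^ 'n::finite) set)"
proof -
  have "continuous_on UNIV (det :: real ^ 'n ^ 'n \<Rightarrow> real)"
    using Ck_on_det[of UNIV 0 "\<lambda>A :: real ^ 'n ^ 'n. A"] by (simp add: continuous_on_component)
  then have "open (det -` (- {0}) :: (real ^ 'n ^ 'n) set)"
    by (intro open_vimage) auto
  moreover have "GL = (det -` (- {0}) :: (real ^ 'n ^ 'n) set)"
    by (auto simp: GL_def invertible_det_nz)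
  ultimately show ?thesis by simp
qed

text \<open>
  The entries of the matrix are polynomials in the parameters.
\<close>

lemma Ck_on_proj_block:
  assumes "open S"
  shows "Ck_on k (\<lambda>w. proj_block (fst w) (fst w *v fst (snd w)) (snd (snd w))) S"
proof -
  note proj = Ck_on_linear[OF bounded_linear_fst assms] Ck_on_linear[OF bounded_linear_snd assms] Ck_on_id[OF assms]
  have "Ck_on k (\<lambda>w. proj_block (fst w) (fst w *v fst (snd w)) (snd (snd w)) $ i $ j) S" for i j
    by (cases i; cases j)
       (simp_all add: matrix_vector_mult_def,
        intro Ck_on_const Ck_on_vec_nth Ck_on_add Ck_on_mult Ck_on_sum assms proj |
        intro Ck_on_const Ck_on_vec_nth Ck_on_add Ck_on_mult Ck_on_sum assms proj)+
  then have "Ck_on k (\<lambda>w. \<chi> i j. proj_block (fst w) (fst w *v fst (snd w)) (snd (snd w)) $ i $ j) S"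
    by (intro Ck_on_vec_lambda assms)
  then show ?thesis by simp
qed

lemma Ck_on_params_of_matrix:
  assumes "open S" and "S \<subseteq> {A \<in> GL. A $ None $ None \<noteq> 0}"
  shows "Ck_on k params_of_matrix S"
proof -
  have nz: "\<And>A. A \<in> S \<Longrightarrow> A $ None $ None \<noteq> 0"
    and det: "\<And>A. A \<in> S \<Longrightarrow> det (schur_complement A) \<noteq> 0"
    using assms(2) schur_complement_in_GL by (auto simp: GL_def invertible_det_nz)
  have entry: "Ck_on k (\<lambda>A. A $ i $ j) S" for i j
    by (intro Ck_on_vec_nth Ck_on_id assms(1))
  have quotient: "Ck_on k (\<lambda>A. A $ i $ j / A $ None $ None) S" for i j
    by (intro Ck_on_divide assms(1) entry nz)
  have column: "Ck_on k (\<lambda>A. pivot_column A $ i) S" for i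
    using quotient by (simp add: pivot_column_def)
  have row: "Ck_on k (\<lambda>A. pivot_row A $ i) S" for i
    using quotient by (simp add: pivot_row_def)
  have schur: "Ck_on k (\<lambda>A. schur_complement A $ i $ j) S" for i j
    unfolding schur_complement_def
    by (simp, intro Ck_on_diff Ck_on_mult quotient column row assms(1))
  have "Ck_on k (\<lambda>A. (\<chi> i j. schur_complement A $ i $ j,
      \<chi> k. det (\<chi> i j. if j = k then pivot_column A $ i else schur_complement A $ i $ j)
             / det (schur_complement A),
      \<chi> j. pivot_row A $ j)) S"
  proof (intro Ck_on_Pair Ck_on_vec_lambda Ck_on_divide Ck_on_det assms(1) schur row det)
    show "Ck_on k (\<lambda>A. (\<chi> i j. if j = l then pivot_column A $ i else schur_complement A $ i $ j) $ i $ j) S" for l i j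
      by (cases "j = l") (simp_all add: column schur)
  qed
  then show ?thesis
    by (simp add: params_of_matrix_def[abs_def])
qed

text \<open>
  The parametrisation factors through a smooth map into the matrix group, and smooth functions on the
  projective group are by definition those that are smooth when pulled back to matrices.
\<close>

lemma smooth_into_proj_of_params:
  "smooth_into_Proj (GL \<times> UNIV \<times> UNIV) (proj_of_params :: _ \<Rightarrow> 'n::finite rproj \<Rightarrow> _)"
proof -
  let ?W = "GL \<times> UNIV \<times> UNIV :: ((real ^ 'n ^ 'n) \<times> (real ^ 'n) \<times> (real ^ 'n)) set"
  let ?\<psi> = "\<lambda>w :: (real ^ 'n ^ 'n) \<times> (real ^ 'n) \<times> (real ^ 'n). proj_block (fst w) (fst w *v fst (snd w)) (snd (snd w))"
  have eq: "proj_of_params = proj_map \<circ> ?\<psi>"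
    by (auto simp: proj_of_params_def)
  have open_W: "open ?W"
    by (intro open_Times open_GL open_UNIV)
  have GL: "?\<psi> ` ?W \<subseteq> GL"
    by (auto simp: proj_block_in_GL_iff)
  have cont: "continuous_on ?W ?\<psi>"
    using Ck_on_proj_block[OF open_W, of 0] by simp
  show ?thesis
    unfolding smooth_into_Proj_def
  proof (intro conjI allI impI)
    have "continuous_map (top_of_set ?W) (top_of_set GL) ?\<psi>"
      using cont GL by auto
    then show "continuous_map (top_of_set ?W) Proj_topology proj_of_params"
      unfolding eq by (rule continuous_map_compose) (rule quotient_imp_continuous_map[OF quotient_map_proj_map])
  next
    fix U :: "('n rproj \<Rightarrow> 'n rproj) set" and g :: "('n rproj \<Rightarrow> 'n rproj) \<Rightarrow> real"
    assume *: "openin Proj_topology U \<and> smooth_from_Proj U g"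
    define T where "T = {A \<in> GL. proj_map A \<in> U}"
    have T: "open T"
      using * openin_open_eq[OF open_GL, of T] by (simp add: T_def openin_Proj_topology)
    define S where "S = {w \<in> ?W. proj_of_params w \<in> U}"
    have S_eq: "S = ?W \<inter> ?\<psi> -` T"
      using GL by (auto simp: S_def T_def eq)
    have S: "open S"
      unfolding S_eq by (rule continuous_open_preimage[OF cont open_W T])
    have "Ck_on k (\<lambda>w. (g \<circ> proj_map) (?\<psi> w)) S" for k
    proof (rule Ck_on_compose[OF S T _ Ck_on_proj_block[OF S]])
      show "?\<psi> ` S \<subseteq> T" by (auto simp: S_eq)
      show "Ck_on k (g \<circ> proj_map) T"
        using * by (simp add: smooth_from_Proj_def smooth_on_def T_def)
    qed
    then show "smooth_on S (g \<circ> proj_of_params)"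
      by (simp add: smooth_on_def eq comp_def)
  qed
qed

text \<open>
  The image corresponds to the matrices in \<open>GL\<close> whose first entry does not vanish, an open set on which
  \<open>params_of_matrix\<close> is a smooth expression for the inverse.
\<close>

lemma diffeo_proj_of_params:
  "diffeo_onto_image_Proj (GL \<times> UNIV \<times> UNIV) (proj_of_params :: _ \<Rightarrow> 'n::finite rproj \<Rightarrow> _)"
proof -
  let ?W = "GL \<times> UNIV \<times> UNIV :: ((real ^ 'n ^ 'n) \<times> (real ^ 'n) \<times> (real ^ 'n)) set"
  define T where "T = {A :: real ^ 'n option ^ 'n option. A \<in> GL \<and> A $ None $ None \<noteq> 0}"
  have T_eq: "{A \<in> GL. proj_map A \<in> proj_of_params ` ?W} = T"
    unfolding T_def by (intro Collect_cong conj_cong refl proj_map_in_image_proj_of_params_iff)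
  have "open {A :: real ^ 'n option ^ 'n option. A $ None $ None \<noteq> 0}"
    by (intro open_Collect_neq continuous_intros)
  then have "open (GL \<inter> {A :: real ^ 'n option ^ 'n option. A $ None $ None \<noteq> 0})"
    by (rule open_Int[OF open_GL])
  moreover have "T = GL \<inter> {A. A $ None $ None \<noteq> 0}"
    by (auto simp: T_def)
  ultimately have T: "open T" by simp
  have image: "proj_of_params ` ?W \<subseteq> Proj"
    by (auto simp: proj_of_params_def Proj_def proj_block_in_GL_iff)
  have "openin (top_of_set GL) T"
    using T by (intro open_openin_trans) (auto simp: T_def open_GL)
  then have "openin Proj_topology (proj_of_params ` ?W)"
    unfolding openin_Proj_topology T_eq using image by blast
  moreover have "smooth_from_Proj (proj_of_params ` ?W) (inv_into ?W proj_of_params)"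
    unfolding smooth_from_Proj_def T_eq smooth_on_def
  proof (rule allI, rule Ck_on_cong[OF T])
    show "Ck_on k params_of_matrix T" for k
      by (rule Ck_on_params_of_matrix[OF T]) (auto simp: T_def)
    show "params_of_matrix A = (inv_into ?W proj_of_params \<circ> proj_map) A" if "A \<in> T" for A
    proof -
      have A: "A \<in> GL" "A $ None $ None \<noteq> 0"
        using that by (simp_all add: T_def)
      show ?thesis
        using inv_into_f_eq[OF inj_on_proj_of_params proj_of_params_of_matrix[OF A]] by simp
    qed
  qed
  ultimately show ?thesis
    unfolding diffeo_onto_image_Proj_def
    by (intro conjI inj_on_proj_of_params smooth_into_proj_of_params)
qed

section \<open>The action on convex bodies\<close>

lemma proj_of_params_affine_chart:
  assumes "M \<in> GL"
  shows "proj_of_params (M, x, \<xi>) (affine_chart k) =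
      hclass (homog (1 + \<xi> \<bullet> k) (M *v k + (1 + \<xi> \<bullet> k) *\<^sub>R (M *v x)))"
    and "homog (1 + \<xi> \<bullet> k) (M *v k + (1 + \<xi> \<bullet> k) *\<^sub>R (M *v x)) \<noteq> 0"
proof -
  have A: "proj_block M (M *v x) \<xi> \<in> GL"
    using assms by (simp add: proj_block_in_GL_iff)
  show "proj_of_params (M, x, \<xi>) (affine_chart k) =
      hclass (homog (1 + \<xi> \<bullet> k) (M *v k + (1 + \<xi> \<bullet> k) *\<^sub>R (M *v x)))"
    using proj_map_hclass[OF A, of "homog 1 k"]
    by (simp add: proj_of_params_def affine_chart_eq_homog proj_block_mult_homog)
  show "homog (1 + \<xi> \<bullet> k) (M *v k + (1 + \<xi> \<bullet> k) *\<^sub>R (M *v x)) \<noteq> 0"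
    using A GL_iff_kernel proj_block_mult_homog[of M "M *v x" \<xi> 1 k] by (metis homog_eq_0_iff one_neq_zero)
qed

lemma affine_coords_proj_of_params:
  assumes "M \<in> GL" and "1 + \<xi> \<bullet> k \<noteq> 0"
  shows "affine_coords (proj_of_params (M, x, \<xi>) (affine_chart k)) = M *v (x + (1 / (1 + \<xi> \<bullet> k)) *\<^sub>R k)"
proof -
  have "affine_coords (proj_of_params (M, x, \<xi>) (affine_chart k)) =
      (1 / (1 + \<xi> \<bullet> k)) *\<^sub>R (M *v k + (1 + \<xi> \<bullet> k) *\<^sub>R (M *v x))"
    unfolding proj_of_params_affine_chart(1)[OF assms(1)]
      affine_coords_hclass[OF proj_of_params_affine_chart(2)[OF assms(1)]]
    by (simp add: vec_eq_iff)
  also have "\<dots> = M *v (x + (1 / (1 + \<xi> \<bullet> k)) *\<^sub>R k)"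
    using assms(2) by (simp add: matrix_vector_right_distrib matrix_vector_mult_scaleR scaleR_add_right)
  finally show ?thesis .
qed

text \<open>
  A sign change would force a zero on the segment from \<open>0\<close>, where the value is \<open>1\<close>, to \<open>k\<close>.
\<close>

lemma convex_affine_nonzero_imp_pos:
  assumes "convex K" and "0 \<in> K" and nz: "\<And>k. k \<in> K \<Longrightarrow> 1 + \<xi> \<bullet> k \<noteq> 0" and "k \<in> K"
  shows "0 < 1 + \<xi> \<bullet> k"
proof (rule ccontr)
  assume "\<not> ?thesis"
  then have neg: "\<xi> \<bullet> k \<le> -1" by simp
  define t where "t = - 1 / (\<xi> \<bullet> k)"
  have t: "0 \<le> t" "t \<le> 1"
    using neg by (simp_all add: t_def divide_simps)
  have "(1 - t) *\<^sub>R 0 + t *\<^sub>R k \<in> K"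
    using assms t by (intro convexD) auto
  then have "1 + \<xi> \<bullet> (t *\<^sub>R k) \<noteq> 0"
    by (intro nz) simp
  then show False
    using neg by (simp add: t_def)
qed

text \<open>
  Avoiding the hyperplane at infinity gives \<open>1 + \<xi> \<bullet> k \<noteq> 0\<close> on \<open>K\<close>, hence \<open>1 + \<xi> \<bullet> k > 0\<close>, which is the
  condition on \<open>\<xi>\<close> for the shifted polar body. The transformed body is then \<open>M\<close> applied to
  \<open>(K\<degree> + \<xi>)\<degree> + x\<close>; since it contains \<open>0\<close> in its interior, so does the latter. This is the
  condition on \<open>x\<close>, and the volume product does not see \<open>M\<close>.
\<close>

lemma vp_proj_of_params:
  assumes K: "K \<in> convex_bodies_0" and M: "M \<in> GL"
    and finite: "proj_of_params (M, x, \<xi>) ` affine_chart ` K \<subseteq> - hyperplane0"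
    and body: "affine_coords ` proj_of_params (M, x, \<xi>) ` affine_chart ` K \<in> convex_bodies_0"
  shows "(x, \<xi>) \<in> vp_shift_dom K"
    and "vp (affine_coords ` proj_of_params (M, x, \<xi>) ` affine_chart ` K) = vp_shift K x \<xi>"
proof -
  have K': "compact K" "convex K" "0 \<in> K"
    using K interior_subset by (auto simp: convex_bodies_0_def)
  have "1 + \<xi> \<bullet> k \<noteq> 0" if "k \<in> K" for k
  proof
    assume "1 + \<xi> \<bullet> k = 0"
    with proj_of_params_affine_chart[OF M, where x = x and \<xi> = \<xi> and k = k]
    have "proj_of_params (M, x, \<xi>) (affine_chart k) \<in> hyperplane0"
      unfolding hyperplane0_def by (metis (mono_tags, lifting) homog_nth(1) mem_Collect_eq)
    with finite that show False by auto
  qed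
  then have pos: "0 < 1 + \<xi> \<bullet> k" if "k \<in> K" for k
    using convex_affine_nonzero_imp_pos[OF K'(2,3)] that by blast
  let ?L = "bipolar_shift K x \<xi>"
  have L: "?L = (\<lambda>k. x + (1 / (1 + \<xi> \<bullet> k)) *\<^sub>R k) ` K"
    by (simp add: bipolar_shift_def polar_shift_polar[OF K' pos] image_image)
  have compact_L: "compact ?L"
    unfolding L using pos by (intro compact_continuous_image K' continuous_intros) (use pos in force)
  have image: "affine_coords ` proj_of_params (M, x, \<xi>) ` affine_chart ` K = (*v) M ` ?L"
    unfolding L image_image
    by (intro image_cong refl affine_coords_proj_of_params[OF M]) (use pos in force)
  have inj: "inj ((*v) M)"
    using M by (auto simp: GL_iff_kernel intro: linear_injective_0[THEN iffD2])
  have "0 \<in> interior ((*v) M ` ?L)"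
    using body by (simp add: image convex_bodies_0_def)
  then have "(*v) M 0 \<in> (*v) M ` interior ?L"
    by (simp add: interior_injective_linear_image inj)
  then have int_L: "0 \<in> interior ?L"
    using inj by (simp only: inj_image_mem_iff)
  with zero_interior_shift_polar[OF K'(1) pos] show "(x, \<xi>) \<in> vp_shift_dom K"
    by (simp add: vp_shift_dom_def)
  show "vp (affine_coords ` proj_of_params (M, x, \<xi>) ` affine_chart ` K) = vp_shift K x \<xi>"
    unfolding image vp_shift_def by (rule vp_linear_image) (simp_all add: inj compact_L int_L)
qed

lemma proj_of_params_identity: "proj_of_params (mat 1, 0, 0) = (id :: 'n::finite rproj \<Rightarrow> _)"
proof -
  have "proj_block (mat 1) 0 (0 :: real ^ 'n) $ i $ j = mat 1 $ i $ j" for i j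
    by (cases i; cases j) (simp_all add: mat_def)
  then have "proj_block (mat 1) 0 (0 :: real ^ 'n) = mat 1"
    by (simp add: vec_eq_iff)
  then show ?thesis
    by (auto simp: proj_of_params_def proj_map_def)
qed

theorem proposition3p2:
  fixes r1 r2 :: real
    and B1 B2 :: "(real ^ 'n::finite) set"
    and V :: "(real ^ 'n) set set"
    and U :: "('n rproj \<Rightarrow> 'n rproj) set"
  assumes "0 < r1" and "0 < r2" and "B1 = ball 0 r1" and "B2 = ball 0 r2" and "B1 \<subset> B2"
    and "V = {K \<in> convex_bodies_0. closure B1 \<subseteq> interior K \<and> interior K \<subseteq> K \<and> K \<subseteq> B2}"
    and "openin Proj_topology U" and "id \<in> U"
    and "\<And>K \<pi>. K \<in> V \<Longrightarrow> \<pi> \<in> U \<Longrightarrow>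
           \<pi> ` affine_chart ` K \<subseteq> - hyperplane0 \<and>
           affine_coords ` \<pi> ` affine_chart ` K \<in> convex_bodies_0"
  shows "\<exists>(W :: ((real ^ 'n ^ 'n) \<times> (real ^ 'n) \<times> (real ^ 'n)) set) \<Psi>.
           open W \<and> W \<subseteq> GL \<times> UNIV \<times> UNIV \<and> (mat 1, 0, 0) \<in> W \<and>
           \<Psi> ` W \<subseteq> Proj \<and> \<Psi> (mat 1, 0, 0) = id \<and>
           diffeo_onto_image_Proj W \<Psi> \<and>
           (\<forall>K\<in>V. \<forall>M x \<xi>. (M, x, \<xi>) \<in> W \<and> \<Psi> (M, x, \<xi>) \<in> U \<longrightarrow>
              (x, \<xi>) \<in> vp_shift_dom K \<and>
              vp (affine_coords ` \<Psi> (M, x, \<xi>) ` affine_chart ` K) = vp_shift K x \<xi>)"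
proof (intro exI conjI ballI allI impI)
  let ?W = "GL \<times> UNIV \<times> UNIV :: ((real ^ 'n ^ 'n) \<times> (real ^ 'n) \<times> (real ^ 'n)) set"
  show "open ?W"
    by (intro open_Times open_GL open_UNIV)
  show "?W \<subseteq> GL \<times> UNIV \<times> UNIV" ..
  show "(mat 1, 0, 0) \<in> ?W"
    by (simp add: GL_iff_kernel)
  show "proj_of_params ` ?W \<subseteq> Proj"
    by (auto simp: proj_of_params_def Proj_def proj_block_in_GL_iff)
  show "proj_of_params (mat 1, 0, 0) = (id :: 'n rproj \<Rightarrow> 'n rproj)"
    by (rule proj_of_params_identity)
  show "diffeo_onto_image_Proj ?W proj_of_params"
    by (rule diffeo_proj_of_params)
  fix K M x \<xi>
  assume "K \<in> V" and *: "(M, x, \<xi>) \<in> ?W \<and> proj_of_params (M, x, \<xi>) \<in> U"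
  then have "K \<in> convex_bodies_0" "M \<in> GL"
    using assms(6) by auto
  moreover have "proj_of_params (M, x, \<xi>) ` affine_chart ` K \<subseteq> - hyperplane0"
    "affine_coords ` proj_of_params (M, x, \<xi>) ` affine_chart ` K \<in> convex_bodies_0"
    using assms(9)[OF \<open>K \<in> V\<close> conjunct2[OF *]] by blast+
  ultimately show "(x, \<xi>) \<in> vp_shift_dom K"
    "vp (affine_coords ` proj_of_params (M, x, \<xi>) ` affine_chart ` K) = vp_shift K x \<xi>"
    by (rule vp_proj_of_params)+
qed

end
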